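(* Let $X$ be a compact metric space with metric $d$ and let $f\in\mathcal C(X)$. The dynamical system $(X,f)$ has shadowing if and only if for every $\epsilon>0$ there exists $\delta>0$ such that if $g\in X^X$ with $\rho(g,f)<\delta$, then each $g$-orbit is $\epsilon$-shadowed by an $f$-orbit.
   Context: $X^X$ is the set of all (not necessarily continuous) functions $X\to X$, with the supremum metric $\rho(f,g)=\sup_{x\in X}d(f(x),g(x))$; $\mathcal C(X)\subseteq X^X$ is the subspace of continuous functions. $\omega=\{0,1,2,\dots\}$. For $h\in X^X$ and $x\in X$, the $h$-orbit of $x$ is the sequence $\langle h^i(x)\rangle_{i\in\omega}$, where $h^0$ is the identity. For $\delta>0$, a $\delta$-pseudo-orbit for $f$ is a sequence $\langle x_i\rangle_{i\in\omega}$ in $X$ with $d(f(x_i),x_{i+1})<\delta$ for all $i\in\omega$. A sequence $\langle x_i\rangle_{i\in\omega}$ $\epsilon$-shadows a sequence $\langle y_i\rangle_{i\in\omega}$ if $d(x_i,y_i)<\epsilon$ for all $i\in\omega$. The system $(X,f)$ has shadowing if for all $\epsilon>0$ there exists $\delta>0$ such that for every $\delta$-pseudo-orbit $\langle x_i\rangle$ for $f$ there exists $z\in X$ with $d(x_i,f^i(z))<\epsilon$ for all $i\in\omega$. *)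

theory Defs
  imports "HOL-Analysis.Analysis"
begin

text \<open>
  A metric space is given by a carrier set X in a type of class \<open>metric_space\<close>, and
  \<open>X \<rightarrow> X\<close> (from \<open>FuncSet\<close>) plays the role of \<open>X\<^sup>X\<close>. Members of \<open>X \<rightarrow> X\<close> may
  be arbitrary off X; all notions below depend only on their values on X.
\<close>

definition cont_self_maps :: "'a::metric_space set \<Rightarrow> ('a \<Rightarrow> 'a) set" where
  "cont_self_maps X = {f \<in> X \<rightarrow> X. continuous_on X f}"

text \<open>
  The supremum is a real supremum, hence meaningful only for nonempty X with the distances
  bounded. The latter is automatic for self-maps of a compact X.
\<close>

definition sup_metric :: "'a::metric_space set \<Rightarrow> ('a \<Rightarrow> 'a) \<Rightarrow> ('a \<Rightarrow> 'a) \<Rightarrow> real" where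
  "sup_metric X f g = (SUP x\<in>X. dist (f x) (g x))"

definition orbit_seq :: "('a \<Rightarrow> 'a) \<Rightarrow> 'a \<Rightarrow> nat \<Rightarrow> 'a" where
  "orbit_seq h x = (\<lambda>i. (h ^^ i) x)"

definition pseudo_orbit ::
  "'a::metric_space set \<Rightarrow> ('a \<Rightarrow> 'a) \<Rightarrow> real \<Rightarrow> (nat \<Rightarrow> 'a) \<Rightarrow> bool" where
  "pseudo_orbit X f \<delta> xs \<longleftrightarrow>
     (\<forall>i. xs i \<in> X) \<and> (\<forall>i. dist (f (xs i)) (xs (Suc i)) < \<delta>)"

definition eps_shadows :: "real \<Rightarrow> (nat \<Rightarrow> 'a::metric_space) \<Rightarrow> (nat \<Rightarrow> 'a) \<Rightarrow> bool" where
  "eps_shadows \<epsilon> xs ys \<longleftrightarrow> (\<forall>i. dist (xs i) (ys i) < \<epsilon>)"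

definition has_shadowing :: "'a::metric_space set \<Rightarrow> ('a \<Rightarrow> 'a) \<Rightarrow> bool" where
  "has_shadowing X f \<longleftrightarrow>
     (\<forall>\<epsilon>>0. \<exists>\<delta>>0. \<forall>xs. pseudo_orbit X f \<delta> xs \<longrightarrow>
        (\<exists>z\<in>X. \<forall>i. dist (xs i) ((f ^^ i) z) < \<epsilon>))"

end

theory Submission
  imports Defs
begin

text \<open>
  If \<open>g\<close> is uniformly close to \<open>f\<close>, every \<open>g\<close>-orbit is a pseudo-orbit of \<open>f\<close>, so shadowing
  implies that orbits of perturbations are shadowed. The converse is the substantial direction,
  because a pseudo-orbit is an orbit of some map only if it is deterministic: equal terms must
  have equal successors (\<open>deterministic_pseudo_orbit_is_orbit\<close>). The plan is to move each term
  of a pseudo-orbit by less than some small \<open>\<eta>\<close> so that it becomes deterministic.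

  A point with infinitely many points of \<open>X\<close> in its \<open>\<eta>\<close>-ball leaves room for this: such
  terms can be made distinct from everything else. By compactness, the set \<open>F\<close> of the
  remaining, \<open>\<eta>\<close>-sparse points is finite, and its members are isolated in \<open>X\<close>. Repeated visits
  to a point \<open>p\<close> of \<open>F\<close> cannot be perturbed away, but they turn out to be harmless:

  \<^item> If \<open>p\<close> is not periodic under \<open>f\<close>, no sufficiently accurate pseudo-orbit returns to \<open>p\<close>
    (\<open>no_pseudo_return\<close>). A shortest return would be a simple cycle, hence an orbit of a
    perturbation of \<open>f\<close>. An \<open>f\<close>-orbit shadowing it within the isolation radius of \<open>p\<close> would pass
    through \<open>p\<close> twice.

  \<^item> If \<open>p\<close> is periodic, a sufficiently accurate pseudo-orbit that starts in \<open>p\<close> is close to the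
    orbit of \<open>p\<close> over one period and so, as \<open>p\<close> is isolated, is back at exactly \<open>p\<close>. Errors do
    not accumulate, and the pseudo-orbit stays close to the orbit of \<open>p\<close> forever
    (\<open>tracks_isolated_periodic\<close>).

  So from its first visit to a periodic point of \<open>F\<close> onwards, the pseudo-orbit is replaced by the
  true orbit of that point; before that visit it meets each point of \<open>F\<close> at most once, and
  its other terms can be moved to new, pairwise distinct places. The result is deterministic.
\<close>

section \<open>Pseudo-orbits and maps near f\<close>

definition near_orbits_shadowed :: "'a::metric_space set \<Rightarrow> ('a \<Rightarrow> 'a) \<Rightarrow> real \<Rightarrow> real \<Rightarrow> bool" where
  "near_orbits_shadowed X f \<epsilon> \<delta> \<longleftrightarrow>
     (\<forall>g \<in> X \<rightarrow> X. sup_metric X g f < \<delta> \<longrightarrow>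
        (\<forall>x\<in>X. \<exists>z\<in>X. eps_shadows \<epsilon> (orbit_seq f z) (orbit_seq g x)))"

definition periodic_pt :: "('a \<Rightarrow> 'a) \<Rightarrow> 'a \<Rightarrow> bool" where
  "periodic_pt f p \<longleftrightarrow> (\<exists>k>0. (f ^^ k) p = p)"

lemma periodic_ptI: "0 < k \<Longrightarrow> (f ^^ k) p = p \<Longrightarrow> periodic_pt f p"
  by (auto simp: periodic_pt_def)

lemma funpow_closed: "f \<in> X \<rightarrow> X \<Longrightarrow> x \<in> X \<Longrightarrow> (f ^^ n) x \<in> X"
  by (induction n) auto

lemma pseudo_orbit_mono: "pseudo_orbit X f \<delta> xs \<Longrightarrow> \<delta> \<le> \<delta>' \<Longrightarrow> pseudo_orbit X f \<delta>' xs"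
  unfolding pseudo_orbit_def by (meson less_le_trans)

lemma pseudo_orbit_shift: "pseudo_orbit X f \<delta> xs \<Longrightarrow> pseudo_orbit X f \<delta> (\<lambda>i. xs (m + i))"
  unfolding pseudo_orbit_def by simp

lemma pseudo_orbit_perturb:
  assumes xs: "pseudo_orbit X f \<delta> xs"
    and w: "\<And>i. w i \<in> X" "\<And>i. dist (xs i) (w i) < \<eta>"
    and uc: "\<And>a b. a \<in> X \<Longrightarrow> b \<in> X \<Longrightarrow> dist a b < \<eta> \<Longrightarrow> dist (f a) (f b) < c"
  shows "pseudo_orbit X f (c + \<delta> + \<eta>) w"
  unfolding pseudo_orbit_def
proof (intro conjI allI w)
  fix i
  have "dist (f (w i)) (w (Suc i)) \<le> dist (f (xs i)) (f (w i))
      + dist (f (xs i)) (xs (Suc i)) + dist (xs (Suc i)) (w (Suc i))"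
    by metric
  moreover have "dist (f (xs i)) (f (w i)) < c"
    using uc xs w by (auto simp: pseudo_orbit_def)
  ultimately show "dist (f (w i)) (w (Suc i)) < c + \<delta> + \<eta>"
    using xs w(2)[of "Suc i"] unfolding pseudo_orbit_def by (smt (verit))
qed

lemma dist_less_of_sup_metric_less:
  assumes "compact X" "g \<in> X \<rightarrow> X" "f \<in> X \<rightarrow> X" "sup_metric X g f < \<delta>" "x \<in> X"
  shows "dist (g x) (f x) < \<delta>"
proof -
  obtain B where "\<And>a b. a \<in> X \<Longrightarrow> b \<in> X \<Longrightarrow> dist a b \<le> B"
    using compact_imp_bounded[OF assms(1)] unfolding bounded_two_points by blast
  then have "bdd_above ((\<lambda>x. dist (g x) (f x)) ` X)"
    using assms(2,3) by (intro bdd_aboveI2[where M = B]) auto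
  then have "dist (g x) (f x) \<le> sup_metric X g f"
    unfolding sup_metric_def by (rule cSUP_upper[OF assms(5)])
  then show ?thesis using assms(4) by simp
qed

text \<open>
  Determinism makes \<open>w i \<mapsto> w (Suc i)\<close> a well-defined map on the terms of \<open>w\<close>, and setting it to
  \<open>f\<close> elsewhere gives the perturbation. The supremum of distances below \<open>\<delta>\<close> may equal \<open>\<delta>\<close>, which
  is why a strictly larger \<open>\<delta>'\<close> appears.
\<close>

lemma deterministic_pseudo_orbit_is_orbit:
  assumes f: "f \<in> X \<rightarrow> X" and w: "pseudo_orbit X f \<delta> w" and less: "\<delta> < \<delta>'" and pos: "0 < \<delta>"
    and det: "\<And>i j. w i = w j \<Longrightarrow> w (Suc i) = w (Suc j)"
  obtains g where "g \<in> X \<rightarrow> X" "sup_metric X g f < \<delta>'" "orbit_seq g (w 0) = w"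
proof
  define g where "g x = (if x \<in> range w then w (Suc (SOME i. w i = x)) else f x)" for x
  have g_w: "g (w i) = w (Suc i)" for i
  proof -
    have "w (SOME j. w j = w i) = w i" by (rule someI) (rule refl)
    then have "w (Suc (SOME j. w j = w i)) = w (Suc i)" by (rule det)
    then show ?thesis unfolding g_def by simp
  qed
  have wX: "w i \<in> X" for i using w by (simp add: pseudo_orbit_def)
  show "g \<in> X \<rightarrow> X" using f wX by (auto simp: g_def)
  have "dist (g x) (f x) \<le> \<delta>" if "x \<in> X" for x
  proof (cases "x \<in> range w")
    case True
    then show ?thesis using w g_w by (auto simp: pseudo_orbit_def dist_commute less_imp_le)
  next
    case False
    then show ?thesis using pos by (simp add: g_def)
  qed
  then have "sup_metric X g f \<le> \<delta>"
    unfolding sup_metric_def using wX by (intro cSUP_least) auto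
  then show "sup_metric X g f < \<delta>'" using less by simp
  have "(g ^^ i) (w 0) = w i" for i
    by (induction i) (auto simp: g_w)
  then show "orbit_seq g (w 0) = w" by (auto simp: orbit_seq_def)
qed

lemma shadow_deterministic_pseudo_orbit:
  assumes "f \<in> X \<rightarrow> X" and "near_orbits_shadowed X f \<epsilon> \<delta>" and "0 < \<delta>"
    and "pseudo_orbit X f (\<delta> / 2) w"
    and "\<And>i j. w i = w j \<Longrightarrow> w (Suc i) = w (Suc j)"
  obtains z where "z \<in> X" "\<And>i. dist ((f ^^ i) z) (w i) < \<epsilon>"
proof -
  obtain g where g: "g \<in> X \<rightarrow> X" "sup_metric X g f < \<delta>" "orbit_seq g (w 0) = w"
    using deterministic_pseudo_orbit_is_orbit[OF assms(1,4) _ _ assms(5), of \<delta>] assms(3)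
    by auto
  moreover have "w 0 \<in> X" using assms(4) by (simp add: pseudo_orbit_def)
  ultimately obtain z where "z \<in> X" "eps_shadows \<epsilon> (orbit_seq f z) (orbit_seq g (w 0))"
    using assms(2) unfolding near_orbits_shadowed_def by blast
  then have "\<And>i. dist ((f ^^ i) z) (w i) < \<epsilon>"
    unfolding g(3) by (simp add: eps_shadows_def orbit_seq_def)
  with \<open>z \<in> X\<close> show ?thesis by (rule that)
qed

section \<open>Returns to an isolated point\<close>

text \<open>
  Shortest returns pass through pairwise distinct points, since a loop in between could be cut
  out. Running around such a simple cycle forever is therefore deterministic, and an \<open>f\<close>-orbit
  that shadows this motion within the isolation radius of \<open>p\<close> has to pass through \<open>p\<close> itself.
\<close>

lemma no_pseudo_return:
  assumes f: "f \<in> X \<rightarrow> X" and hyp: "near_orbits_shadowed X f s \<delta>" and pos: "0 < \<delta>"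
    and iso: "\<And>x. x \<in> X \<Longrightarrow> dist x p < s \<Longrightarrow> x = p" and nper: "\<not> periodic_pt f p"
    and xs: "pseudo_orbit X f (\<delta> / 2) xs" "xs 0 = p" and n: "0 < n"
  shows "xs n \<noteq> p"
proof
  assume "xs n = p"
  define R where "R n \<longleftrightarrow> 0 < n \<and> (\<exists>xs. pseudo_orbit X f (\<delta> / 2) xs \<and> xs 0 = p \<and> xs n = p)" for n
  define k where "k = (LEAST n. R n)"
  have "R n" using xs n \<open>xs n = p\<close> by (auto simp: R_def)
  then have "R k" unfolding k_def by (rule LeastI)
  then obtain ys where ys: "pseudo_orbit X f (\<delta> / 2) ys" "ys 0 = p" "ys k = p" and k: "0 < k"
    by (auto simp: R_def)
  have distinct: "ys i \<noteq> ys j" if ij: "i < j" "j < k" for i j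
  proof
    assume eq: "ys i = ys j"
    define zs where "zs l = (if l \<le> i then ys l else ys (l + (j - i)))" for l
    have "dist (f (zs l)) (zs (Suc l)) < \<delta> / 2" for l
    proof (cases "l = i")
      case True
      then show ?thesis using ys(1) eq ij by (simp add: zs_def pseudo_orbit_def)
    next
      case False
      then show ?thesis using ys(1) by (auto simp: zs_def pseudo_orbit_def)
    qed
    then have "pseudo_orbit X f (\<delta> / 2) zs"
      using ys(1) by (simp add: pseudo_orbit_def zs_def)
    moreover have "zs 0 = p" "zs (k - (j - i)) = p" "0 < k - (j - i)"
      using ij ys(2,3) by (auto simp: zs_def)
    ultimately have "R (k - (j - i))" by (auto simp: R_def)
    then have "k \<le> k - (j - i)" unfolding k_def by (rule Least_le)
    then show False using ij by simp
  qed
  define w where "w i = ys (i mod k)" for i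
  have w_Suc: "w (Suc i) = ys (Suc (i mod k))" for i
    using ys(2,3) by (simp add: w_def mod_Suc)
  have "pseudo_orbit X f (\<delta> / 2) w"
    using ys(1) unfolding pseudo_orbit_def w_Suc by (simp add: w_def)
  moreover have "w (Suc i) = w (Suc j)" if "w i = w j" for i j
  proof -
    have "i mod k = j mod k"
      using that distinct k unfolding w_def by (metis linorder_neqE_nat mod_less_divisor)
    then show ?thesis by (simp add: w_Suc)
  qed
  ultimately obtain z where z: "z \<in> X" "\<And>i. dist ((f ^^ i) z) (w i) < s"
    using shadow_deterministic_pseudo_orbit[OF f hyp pos] by metis
  have "z = p" using z(2)[of 0] z(1) iso ys(2) by (simp add: w_def)
  moreover have "(f ^^ k) z = p"
    using z(2)[of k] ys(2) by (intro iso funpow_closed[OF f z(1)]) (simp add: w_def)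
  ultimately show False using nper k by (auto intro: periodic_ptI)
qed

lemma finite_time_tracking:
  assumes f: "f \<in> X \<rightarrow> X" and uc: "uniformly_continuous_on X f" and "0 < e"
  obtains \<delta> where "0 < \<delta>"
    "\<And>xs i. pseudo_orbit X f \<delta> xs \<Longrightarrow> i \<le> k \<Longrightarrow> dist (xs i) ((f ^^ i) (xs 0)) < e"
proof -
  have "\<exists>\<delta>>0. \<forall>xs i. pseudo_orbit X f \<delta> xs \<longrightarrow> i \<le> k \<longrightarrow> dist (xs i) ((f ^^ i) (xs 0)) < e"
    using \<open>0 < e\<close>
  proof (induction k arbitrary: e)
    case 0
    then show ?case by (auto intro: exI[of _ 1])
  next
    case (Suc k)
    obtain d where d: "0 < d" "\<And>a b. a \<in> X \<Longrightarrow> b \<in> X \<Longrightarrow> dist a b < d \<Longrightarrow> dist (f a) (f b) < e / 2"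
      using uc Suc.prems unfolding uniformly_continuous_on_def by (metis dist_commute half_gt_zero)
    obtain \<delta> where \<delta>: "0 < \<delta>" "\<And>xs i. pseudo_orbit X f \<delta> xs \<Longrightarrow> i \<le> k \<Longrightarrow>
        dist (xs i) ((f ^^ i) (xs 0)) < min d e"
      using Suc.IH[of "min d e"] Suc.prems d(1) by auto
    show ?case
    proof (intro exI[of _ "min \<delta> (e / 2)"] conjI allI impI)
      show "0 < min \<delta> (e / 2)" using \<delta> Suc.prems by simp
      fix xs i assume xs: "pseudo_orbit X f (min \<delta> (e / 2)) xs" and i: "i \<le> Suc k"
      have near: "dist (xs j) ((f ^^ j) (xs 0)) < min d e" if "j \<le> k" for j
        using \<delta>(2)[OF pseudo_orbit_mono[OF xs] that] by simp
      have xsX: "xs j \<in> X" for j using xs by (simp add: pseudo_orbit_def)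
      show "dist (xs i) ((f ^^ i) (xs 0)) < e"
      proof (cases "i \<le> k")
        case True
        then show ?thesis using near by auto
      next
        case False
        with i have "i = Suc k" by simp
        moreover have "dist (f (xs k)) (f ((f ^^ k) (xs 0))) < e / 2"
          using near[of k] d(2) xsX funpow_closed[OF f] by simp
        moreover have "dist (f (xs k)) (xs (Suc k)) < e / 2"
          using xs by (simp add: pseudo_orbit_def)
        ultimately show ?thesis
          using dist_triangle_half_r by auto
      qed
    qed
  qed
  then show ?thesis using that by blast
qed

text \<open>
  Within one period, tracking is a finite-time statement. With an accuracy below the isolation
  radius it puts the pseudo-orbit back on \<open>p\<close> exactly, so that the next period starts anew.
\<close>

lemma tracks_isolated_periodic:
  assumes f: "f \<in> X \<rightarrow> X" and uc: "uniformly_continuous_on X f"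
    and iso: "\<And>x. x \<in> X \<Longrightarrow> dist x p < s \<Longrightarrow> x = p" and pos: "0 < s" "0 < \<eta>"
    and per: "periodic_pt f p"
  obtains \<delta> where "0 < \<delta>"
    "\<And>xs i. pseudo_orbit X f \<delta> xs \<Longrightarrow> xs 0 = p \<Longrightarrow> dist (xs i) ((f ^^ i) p) < \<eta>"
proof -
  obtain k where k: "0 < k" "(f ^^ k) p = p" using per by (auto simp: periodic_pt_def)
  obtain \<delta> where \<delta>: "0 < \<delta>" "\<And>xs i. pseudo_orbit X f \<delta> xs \<Longrightarrow> i \<le> k \<Longrightarrow>
      dist (xs i) ((f ^^ i) (xs 0)) < min s \<eta>"
    using finite_time_tracking[OF f uc, of "min s \<eta>" k] pos by auto
  have "dist (xs i) ((f ^^ i) p) < \<eta>" if xs: "pseudo_orbit X f \<delta> xs" "xs 0 = p" for xs i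
  proof -
    have home: "xs (q * k) = p" for q
    proof (induction q)
      case 0
      then show ?case using xs by simp
    next
      case (Suc q)
      have "dist (xs (q * k + k)) p < s"
        using \<delta>(2)[OF pseudo_orbit_shift[OF xs(1), of "q * k"], of k] Suc k by simp
      then show ?case using iso xs(1) by (auto simp: pseudo_orbit_def add.commute)
    qed
    have "dist (xs (i div k * k + i mod k)) ((f ^^ (i mod k)) p) < \<eta>"
      using \<delta>(2)[OF pseudo_orbit_shift[OF xs(1), of "i div k * k"], of "i mod k"] home k(1) by simp
    then show ?thesis using funpow_mod_eq[OF k(2), of i] by simp
  qed
  then show ?thesis using that \<delta>(1) by blast
qed

section \<open>Sparse points\<close>

definition sparse_points :: "'a::metric_space set \<Rightarrow> real \<Rightarrow> 'a set" where
  "sparse_points X \<eta> = {x \<in> X. finite (X \<inter> ball x \<eta>)}"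

text \<open>
  Otherwise the sparse points would accumulate somewhere, and a sparse point near the limit
  would have infinitely many others in its ball.
\<close>

lemma finite_sparse_points:
  assumes "compact X" and "0 < \<eta>"
  shows "finite (sparse_points X \<eta>)"
proof (rule ccontr)
  let ?F = "sparse_points X \<eta>"
  assume "infinite ?F"
  moreover have "?F \<subseteq> X" by (auto simp: sparse_points_def)
  ultimately obtain l where "l islimpt ?F"
    using assms(1) unfolding compact_eq_Bolzano_Weierstrass by blast
  then have inf: "infinite (?F \<inter> ball l (\<eta> / 2))"
    using assms(2) by (simp add: islimpt_eq_infinite_ball)
  then obtain p where p: "p \<in> ?F" "dist l p < \<eta> / 2"
    by (metis Int_iff finite.emptyI mem_ball ex_in_conv)
  have "?F \<inter> ball l (\<eta> / 2) \<subseteq> X \<inter> ball p \<eta>"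
  proof
    fix x assume x: "x \<in> ?F \<inter> ball l (\<eta> / 2)"
    then have "dist p x < \<eta>" using p(2) dist_triangle_half_r[of l p \<eta> x] by simp
    then show "x \<in> X \<inter> ball p \<eta>" using x by (simp add: sparse_points_def)
  qed
  moreover have "finite (X \<inter> ball p \<eta>)" using p(1) by (simp add: sparse_points_def)
  ultimately show False using inf finite_subset by blast
qed

lemma sparse_point_isolated:
  assumes "p \<in> sparse_points X \<eta>" and "0 < \<eta>"
  obtains s where "0 < s" "\<And>x. x \<in> X \<Longrightarrow> dist x p < s \<Longrightarrow> x = p"
proof -
  have "finite (X \<inter> ball p \<eta>)" using assms(1) by (simp add: sparse_points_def)
  then obtain d where d: "0 < d" "\<And>x. x \<in> X \<inter> ball p \<eta> \<Longrightarrow> x \<noteq> p \<Longrightarrow> d \<le> dist p x"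
    using finite_set_avoid by metis
  show ?thesis
  proof
    show "0 < min d \<eta>" using d(1) assms(2) by simp
    show "x = p" if x: "x \<in> X" "dist x p < min d \<eta>" for x
    proof (rule ccontr)
      assume "x \<noteq> p"
      then have "d \<le> dist p x" using x by (intro d(2)) (auto simp: dist_commute)
      then show False using x by (simp add: dist_commute)
    qed
  qed
qed

text \<open>
  A single accuracy serves all sparse points. For a non-periodic point, the shadowing of
  perturbed orbits is used at the scale of its own isolation radius.
\<close>

lemma sparse_point_returns:
  assumes "compact X" and f: "f \<in> X \<rightarrow> X" and uc: "uniformly_continuous_on X f" and \<eta>: "0 < \<eta>"
    and hyp: "\<And>\<epsilon>. 0 < \<epsilon> \<Longrightarrow> \<exists>\<delta>>0. near_orbits_shadowed X f \<epsilon> \<delta>"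
  obtains \<delta> where "0 < \<delta>"
    "\<And>p xs n. p \<in> sparse_points X \<eta> \<Longrightarrow> \<not> periodic_pt f p \<Longrightarrow> pseudo_orbit X f \<delta> xs \<Longrightarrow>
       xs 0 = p \<Longrightarrow> 0 < n \<Longrightarrow> xs n \<noteq> p"
    "\<And>p xs i. p \<in> sparse_points X \<eta> \<Longrightarrow> periodic_pt f p \<Longrightarrow> pseudo_orbit X f \<delta> xs \<Longrightarrow>
       xs 0 = p \<Longrightarrow> dist (xs i) ((f ^^ i) p) < \<eta>"
proof -
  let ?F = "sparse_points X \<eta>"
  define Q where "Q p \<delta> \<longleftrightarrow> (\<forall>xs. pseudo_orbit X f \<delta> xs \<longrightarrow> xs 0 = p \<longrightarrow>
      (if periodic_pt f p then \<forall>i. dist (xs i) ((f ^^ i) p) < \<eta> else \<forall>n>0. xs n \<noteq> p))" for p \<delta>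
  have "\<exists>\<delta>>0. Q p \<delta>" if p: "p \<in> ?F" for p
  proof -
    obtain s where s: "0 < s" "\<And>x. x \<in> X \<Longrightarrow> dist x p < s \<Longrightarrow> x = p"
      using sparse_point_isolated[OF p \<eta>] by blast
    show ?thesis
    proof (cases "periodic_pt f p")
      case True
      obtain \<delta> where "0 < \<delta>"
        "\<And>xs i. pseudo_orbit X f \<delta> xs \<Longrightarrow> xs 0 = p \<Longrightarrow> dist (xs i) ((f ^^ i) p) < \<eta>"
        using tracks_isolated_periodic[OF f uc s(2) s(1) \<eta> True] by metis
      with True show ?thesis unfolding Q_def by auto
    next
      case False
      obtain \<delta> where \<delta>: "0 < \<delta>" "near_orbits_shadowed X f s \<delta>" using hyp[OF s(1)] by blast
      have "Q p (\<delta> / 2)"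
        unfolding Q_def using no_pseudo_return[OF f \<delta>(2,1) s(2) False] False by auto
      then show ?thesis using \<delta>(1) half_gt_zero by blast
    qed
  qed
  then obtain D where D: "\<And>p. p \<in> ?F \<Longrightarrow> 0 < D p \<and> Q p (D p)" by metis
  define \<delta> where "\<delta> = Min (insert 1 (D ` ?F))"
  have fin: "finite (insert 1 (D ` ?F))" using finite_sparse_points[OF assms(1) \<eta>] by simp
  have "0 < \<delta>" unfolding \<delta>_def using fin D by (subst Min_gr_iff) auto
  moreover have "Q p \<delta>" if "p \<in> ?F" for p
  proof -
    have "\<delta> \<le> D p" unfolding \<delta>_def using fin that by (intro Min_le) auto
    then show ?thesis using D[OF that] unfolding Q_def by (blast intro: pseudo_orbit_mono)
  qed
  ultimately show ?thesis using that unfolding Q_def by (metis (no_types, lifting))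
qed

section \<open>Making pseudo-orbits deterministic\<close>

lemma distinct_representatives_avoiding:
  fixes S :: "nat \<Rightarrow> 'a set"
  assumes inf: "\<And>i. i \<in> I \<Longrightarrow> infinite (S i)" and fin: "finite A"
  obtains y where "inj_on y I" "\<And>i. i \<in> I \<Longrightarrow> y i \<in> S i - A"
proof -
  have "\<exists>y. \<forall>i. i \<in> I \<longrightarrow> y i \<in> S i - A - y ` {..<i}"
  proof (rule dependent_wf_choice[OF wf_less_than])
    fix y z :: "nat \<Rightarrow> 'a" and i r
    assume "\<And>j. (j, i) \<in> less_than \<Longrightarrow> y j = z j"
    then have "y ` {..<i} = z ` {..<i}" by (intro image_cong) auto
    then show "(i \<in> I \<longrightarrow> r \<in> S i - A - y ` {..<i}) = (i \<in> I \<longrightarrow> r \<in> S i - A - z ` {..<i})"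
      by simp
  next
    fix i and y :: "nat \<Rightarrow> 'a"
    have "S i - A - y ` {..<i} \<noteq> {}" if "i \<in> I"
      using inf[OF that] fin by (metis Diff_infinite_finite finite.emptyI finite_imageI finite_lessThan)
    then show "\<exists>r. i \<in> I \<longrightarrow> r \<in> S i - A - y ` {..<i}" by blast
  qed
  then obtain y where y: "\<And>i. i \<in> I \<Longrightarrow> y i \<in> S i - A - y ` {..<i}" by blast
  have "inj_on y I" using y by (intro linorder_inj_onI') (metis DiffD2 imageI lessThan_iff)
  then show ?thesis using that y by blast
qed

lemma finite_periodic_orbit:
  assumes "periodic_pt f p"
  shows "finite (range (\<lambda>i. (f ^^ i) p))"
proof -
  obtain k where k: "0 < k" "(f ^^ k) p = p" using assms by (auto simp: periodic_pt_def)
  have "range (\<lambda>i. (f ^^ i) p) \<subseteq> (\<lambda>i. (f ^^ i) p) ` {..<k}"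
    using k(1) funpow_mod_eq[OF k(2)] by (force intro: rev_image_eqI[of "_ mod k"])
  then show ?thesis by (rule finite_subset) simp
qed

lemma periodic_pt_funpow: "periodic_pt f p \<Longrightarrow> periodic_pt f ((f ^^ i) p)"
  unfolding periodic_pt_def by (metis add.commute funpow_add o_apply)

text \<open>
  The hypotheses on \<open>xs\<close> are the two conclusions of the preceding section, for the finite set \<open>F\<close>
  of points that are not moved. The new terms must avoid \<open>F\<close>, as well as the orbits of its
  periodic points, on one of which the new sequence ends if \<open>xs\<close> ever meets such a point.
\<close>

lemma deterministic_perturbation:
  assumes f: "f \<in> X \<rightarrow> X" and xsX: "\<And>i. xs i \<in> X" and \<eta>: "0 < \<eta>"
    and fin: "finite F" and rich: "\<And>x. x \<in> X \<Longrightarrow> x \<notin> F \<Longrightarrow> infinite (X \<inter> ball x \<eta>)"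
    and no_return: "\<And>i j. i < j \<Longrightarrow> xs i \<in> F \<Longrightarrow> \<not> periodic_pt f (xs i) \<Longrightarrow> xs j \<noteq> xs i"
    and track: "\<And>m i. xs m \<in> F \<Longrightarrow> periodic_pt f (xs m) \<Longrightarrow>
      dist (xs (m + i)) ((f ^^ i) (xs m)) < \<eta>"
  obtains w where "\<And>i. w i \<in> X" "\<And>i. dist (xs i) (w i) < \<eta>"
    "\<And>i j. w i = w j \<Longrightarrow> w (Suc i) = w (Suc j)"
proof -
  define F\<^sub>P where "F\<^sub>P = {p \<in> F. periodic_pt f p}"
  define A where "A = F \<union> (\<Union>p\<in>F\<^sub>P. range (\<lambda>i. (f ^^ i) p))"
  have "finite A"
    unfolding A_def F\<^sub>P_def using fin finite_periodic_orbit by auto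
  then obtain y where y_inj: "inj_on y {i. xs i \<notin> F}"
    and y: "\<And>i. xs i \<notin> F \<Longrightarrow> y i \<in> X \<inter> ball (xs i) \<eta> - A"
    using distinct_representatives_avoiding[of "{i. xs i \<notin> F}" "\<lambda>i. X \<inter> ball (xs i) \<eta>" A]
      rich[OF xsX] by auto
  define late where "late i \<longleftrightarrow> (\<exists>k\<le>i. xs k \<in> F\<^sub>P)" for i
  \<comment> \<open>The first visit to a periodic point of \<open>F\<close>; an arbitrary index if there is none.\<close>
  define m where "m = (LEAST k. xs k \<in> F\<^sub>P)"
  have m: "m \<le> i" "xs m \<in> F\<^sub>P" if "late i" for i
  proof -
    obtain k where k: "k \<le> i" "xs k \<in> F\<^sub>P" using \<open>late i\<close> by (auto simp: late_def)
    then show "xs m \<in> F\<^sub>P" "m \<le> i"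
      unfolding m_def by (auto intro: LeastI Least_le[THEN order_trans])
  qed
  define w where "w i = (if late i then (f ^^ (i - m)) (xs m) else if xs i \<in> F then xs i else y i)" for i
  have not_late: "xs i \<notin> F\<^sub>P" if "\<not> late i" for i using that by (auto simp: late_def)
  have w_early: "w i \<notin> (\<Union>p\<in>F\<^sub>P. range (\<lambda>k. (f ^^ k) p))" if "\<not> late i" for i
  proof (cases "xs i \<in> F")
    case True
    then have "\<not> periodic_pt f (xs i)" using not_late[OF that] by (auto simp: F\<^sub>P_def)
    then show ?thesis
      using True that periodic_pt_funpow by (fastforce simp: w_def F\<^sub>P_def)
  next
    case False
    then show ?thesis using that y[OF False] by (auto simp: w_def A_def)
  qed
  have w_late: "w i \<in> (\<Union>p\<in>F\<^sub>P. range (\<lambda>k. (f ^^ k) p))" if "late i" for i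
    using that m by (auto simp: w_def)
  show ?thesis
  proof
    show "w i \<in> X" for i
      using xsX y funpow_closed[OF f] by (auto simp: w_def)
    show "dist (xs i) (w i) < \<eta>" for i
    proof (cases "late i")
      case True
      then show ?thesis using track[of m "i - m"] m by (auto simp: w_def F\<^sub>P_def)
    next
      case False
      then show ?thesis using y[of i] \<eta> by (auto simp: w_def)
    qed
    show "w (Suc i) = w (Suc j)" if eq: "w i = w j" for i j
    proof (cases "late i")
      case True
      with eq w_early w_late have "late j" by metis
      have step: "w (Suc l) = f (w l)" if "late l" for l
      proof -
        have "late (Suc l)" using that unfolding late_def by (meson le_SucI)
        then show ?thesis using that m(1)[OF that] by (simp add: w_def Suc_diff_le)
      qed
      show ?thesis using step True \<open>late j\<close> eq by simp
    next
      case False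
      with eq w_early w_late have "\<not> late j" by metis
      have "i = j"
      proof (cases "xs i \<in> F")
        case True
        have "xs j \<in> F"
          using y[of j] eq True False \<open>\<not> late j\<close> by (auto simp: w_def A_def split: if_splits)
        then have "xs i = xs j" using eq True False \<open>\<not> late j\<close> by (simp add: w_def)
        then show ?thesis
          using no_return[of i j] no_return[of j i] True not_late[OF False]
          by (cases i j rule: linorder_cases) (auto simp: F\<^sub>P_def)
      next
        case notF: False
        have "xs j \<notin> F"
          using y[of i] eq notF False \<open>\<not> late j\<close> by (auto simp: w_def A_def split: if_splits)
        then show ?thesis
          using y_inj eq notF False \<open>\<not> late j\<close> by (auto simp: w_def inj_on_def)
      qed
      then show ?thesis by simp
    qed
  qed
qed

section \<open>The characterisation of shadowing\<close>

lemma shadowing_imp_near_orbits_shadowed: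
  assumes "compact X" and f: "f \<in> X \<rightarrow> X" and "has_shadowing X f" and "0 < \<epsilon>"
  shows "\<exists>\<delta>>0. near_orbits_shadowed X f \<epsilon> \<delta>"
proof -
  obtain \<delta> where \<delta>: "0 < \<delta>" "\<And>xs. pseudo_orbit X f \<delta> xs \<Longrightarrow>
      \<exists>z\<in>X. \<forall>i. dist (xs i) ((f ^^ i) z) < \<epsilon>"
    using assms(3,4) unfolding has_shadowing_def by blast
  have "near_orbits_shadowed X f \<epsilon> \<delta>"
    unfolding near_orbits_shadowed_def
  proof (intro ballI impI)
    fix g x assume g: "g \<in> X \<rightarrow> X" "sup_metric X g f < \<delta>" and x: "x \<in> X"
    have "pseudo_orbit X f \<delta> (orbit_seq g x)"
      using dist_less_of_sup_metric_less[OF assms(1) g(1) f g(2)] funpow_closed[OF g(1) x]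
      by (simp add: pseudo_orbit_def orbit_seq_def dist_commute)
    then show "\<exists>z\<in>X. eps_shadows \<epsilon> (orbit_seq f z) (orbit_seq g x)"
      using \<delta>(2) by (fastforce simp: eps_shadows_def orbit_seq_def dist_commute)
  qed
  then show ?thesis using \<delta>(1) by blast
qed

lemma near_orbits_shadowed_imp_shadowing:
  assumes X: "compact X" and f: "f \<in> X \<rightarrow> X" "continuous_on X f"
    and hyp: "\<And>\<epsilon>. 0 < \<epsilon> \<Longrightarrow> \<exists>\<delta>>0. near_orbits_shadowed X f \<epsilon> \<delta>"
  shows "has_shadowing X f"
  unfolding has_shadowing_def
proof (intro allI impI)
  fix \<epsilon> :: real assume \<epsilon>: "0 < \<epsilon>"
  have uc: "uniformly_continuous_on X f"
    using compact_uniformly_continuous[OF f(2) X] .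
  obtain \<delta>\<^sub>1 where \<delta>1: "0 < \<delta>\<^sub>1" "near_orbits_shadowed X f (\<epsilon> / 2) \<delta>\<^sub>1"
    using hyp[of "\<epsilon> / 2"] \<epsilon> by auto
  \<comment> \<open>The perturbed sequence has an error of \<open>\<delta>\<^sub>1 / 2\<close>: one third each from \<open>f\<close> being applied to a
      moved point, from the pseudo-orbit itself, and from moving the successor.\<close>
  obtain d where d: "0 < d" "\<And>a b. a \<in> X \<Longrightarrow> b \<in> X \<Longrightarrow> dist a b < d \<Longrightarrow> dist (f a) (f b) < \<delta>\<^sub>1 / 6"
    using uc \<delta>1(1) unfolding uniformly_continuous_on_def
    by (metis dist_commute divide_pos_pos zero_less_numeral)
  define \<eta> where "\<eta> = min d (min (\<epsilon> / 2) (\<delta>\<^sub>1 / 6))"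
  have \<eta>: "0 < \<eta>" "\<eta> \<le> d" "\<eta> \<le> \<epsilon> / 2" "\<eta> \<le> \<delta>\<^sub>1 / 6"
    using d(1) \<epsilon> \<delta>1(1) by (auto simp: \<eta>_def)
  let ?F = "sparse_points X \<eta>"
  obtain \<delta>\<^sub>2 where \<delta>2: "0 < \<delta>\<^sub>2"
    and no_return: "\<And>p xs n. p \<in> ?F \<Longrightarrow> \<not> periodic_pt f p \<Longrightarrow> pseudo_orbit X f \<delta>\<^sub>2 xs \<Longrightarrow>
       xs 0 = p \<Longrightarrow> 0 < n \<Longrightarrow> xs n \<noteq> p"
    and track: "\<And>p xs i. p \<in> ?F \<Longrightarrow> periodic_pt f p \<Longrightarrow> pseudo_orbit X f \<delta>\<^sub>2 xs \<Longrightarrow>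
       xs 0 = p \<Longrightarrow> dist (xs i) ((f ^^ i) p) < \<eta>"
    by (rule sparse_point_returns[OF X f(1) uc \<eta>(1) hyp]) blast+
  define \<delta> where "\<delta> = min \<delta>\<^sub>2 (\<delta>\<^sub>1 / 6)"
  have "\<exists>z\<in>X. \<forall>i. dist (xs i) ((f ^^ i) z) < \<epsilon>" if xs: "pseudo_orbit X f \<delta> xs" for xs
  proof -
    have xs2: "pseudo_orbit X f \<delta>\<^sub>2 (\<lambda>i. xs (m + i))" for m
      using pseudo_orbit_shift[OF pseudo_orbit_mono[OF xs]] by (simp add: \<delta>_def)
    have no_return': "xs j \<noteq> xs i" if "i < j" "xs i \<in> ?F" "\<not> periodic_pt f (xs i)" for i j
      using no_return[OF that(2,3) xs2[of i], of "j - i"] that(1) by simp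
    have track': "dist (xs (m + i)) ((f ^^ i) (xs m)) < \<eta>"
      if "xs m \<in> ?F" "periodic_pt f (xs m)" for m i
      using track[OF that xs2[of m]] by simp
    have xsX: "xs i \<in> X" for i using xs by (simp add: pseudo_orbit_def)
    have rich: "infinite (X \<inter> ball x \<eta>)" if "x \<in> X" "x \<notin> ?F" for x
      using that by (simp add: sparse_points_def)
    obtain w where w: "\<And>i. w i \<in> X" "\<And>i. dist (xs i) (w i) < \<eta>"
      and det: "\<And>i j. w i = w j \<Longrightarrow> w (Suc i) = w (Suc j)"
      using deterministic_perturbation[OF f(1) xsX \<eta>(1) finite_sparse_points[OF X \<eta>(1)]
          rich no_return' track'] by blast
    have "pseudo_orbit X f (\<delta>\<^sub>1 / 6 + \<delta> + \<eta>) w"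
      using pseudo_orbit_perturb[OF xs w] d(2) \<eta>(2) by force
    then have "pseudo_orbit X f (\<delta>\<^sub>1 / 2) w"
      by (rule pseudo_orbit_mono) (use \<eta>(4) in \<open>simp add: \<delta>_def\<close>)
    then obtain z where z: "z \<in> X" "\<And>i. dist ((f ^^ i) z) (w i) < \<epsilon> / 2"
      using shadow_deterministic_pseudo_orbit[OF f(1) \<delta>1(2,1)] det by metis
    have "dist (xs i) ((f ^^ i) z) < \<epsilon>" for i
      using z(2)[of i] less_le_trans[OF w(2)[of i] \<eta>(3)] by (rule dist_triangle_half_l[rotated])
    then show ?thesis using z(1) by blast
  qed
  moreover have "0 < \<delta>" using \<delta>2 \<delta>1(1) by (simp add: \<delta>_def)
  ultimately show "\<exists>\<delta>>0. \<forall>xs. pseudo_orbit X f \<delta> xs \<longrightarrow>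
      (\<exists>z\<in>X. \<forall>i. dist (xs i) ((f ^^ i) z) < \<epsilon>)" by blast
qed

theorem theorem7:
  fixes X :: "'a::metric_space set" and f :: "'a \<Rightarrow> 'a"
  assumes "compact X" and "f \<in> cont_self_maps X"
  shows "has_shadowing X f \<longleftrightarrow>
    (\<forall>\<epsilon>>0. \<exists>\<delta>>0. \<forall>g \<in> X \<rightarrow> X. sup_metric X g f < \<delta> \<longrightarrow>
       (\<forall>x\<in>X. \<exists>z\<in>X. eps_shadows \<epsilon> (orbit_seq f z) (orbit_seq g x)))"
proof -
  have f: "f \<in> X \<rightarrow> X" "continuous_on X f" using assms(2) by (auto simp: cont_self_maps_def)
  have "has_shadowing X f \<longleftrightarrow> (\<forall>\<epsilon>>0. \<exists>\<delta>>0. near_orbits_shadowed X f \<epsilon> \<delta>)"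
    using shadowing_imp_near_orbits_shadowed[OF assms(1) f(1)]
      near_orbits_shadowed_imp_shadowing[OF assms(1) f] by blast
  then show ?thesis unfolding near_orbits_shadowed_def .
qed

end
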